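(* Let $X\subset\mathbb{C}^2$ be a reduced algebraic curve, let $p=(p_1,p_2)\in X_{\mathrm{reg}}$ and let $(x(t),y(t))$ be a local parametrization of $X$ at $p$. (a) If $p$ is not a flex point, then there exists a unique $u\in\mathbb{C}^2$ such that $p$ is an attractor for $D_u$. (b) If $p$ is a flex point, and if the tangent to $X$ at $p$ is not isotropic, then $p$ is not an attractor for $D_u$, for every $u\in\Delta_{ED}(X)$. (c) If $p$ is a flex point, and if the tangent to $X$ at $p$ is isotropic, then $p$ is an attractor for $D_u$ for every point $u$ on the line tangent to $X$ at $p$.
   Context: For $u=(u_1,u_2)\in\mathbb{C}^2$, $D_u(x,y)=(x-u_1)^2+(y-u_2)^2$; $X_{\mathrm{reg}}$ is the smooth part of $X$. A point $p\in X_{\mathrm{reg}}$ is an attractor for $D_u$ if it is a critical point of $D_u|_{X_{\mathrm{reg}}}$ which is not a Morse (nondegenerate) critical point (equivalently, more than one Morse point of a Morse deformation of $D_u$ abuts to $p$); i.e. with $h(t,u)=x'(t)(x(t)-u_1)+y'(t)(y(t)-u_2)$ and $p=(x(t_0),y(t_0))$, $\operatorname{ord}_{t_0}h(t,u)>1$. With $p=(x(t_0),y(t_0))$, $p$ is a flex point if $x'(t_0)y''(t_0)-y'(t_0)x''(t_0)=0$; the tangent line at $p$ is isotropic if $x'(t_0)^2+y'(t_0)^2=0$. These conditions do not depend on the parametrization. Let $\mathcal{E}_X\subset X\times\mathbb{C}^2$ be the closure of $\{(\mathbf{x},u)\in X_{\mathrm{reg}}\times\mathbb{C}^2\mid\langle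 u-\mathbf{x},v\rangle=0\ \forall v\in T_{\mathbf{x}}X_{\mathrm{reg}}\}$, where $\langle a,b\rangle=a_1b_1+a_2b_2$, and $\pi_2:\mathcal{E}_X\to\mathbb{C}^2$ the second projection. $\mathrm{EDdeg}(X)$ is the number of Morse points of $D_u|_{X_{\mathrm{reg}}}$ for generic $u$, and $\Delta_{ED}(X)$ is the set of $u\in\mathbb{C}^2$ such that $\pi_2^{-1}(u)$ has cardinality (without multiplicities) different from $\mathrm{EDdeg}(X)$. *)

theory Defs
  imports "HOL-Complex_Analysis.Complex_Analysis"
begin

section \<open>Plane algebraic curves\<close>

text \<open>
  A polynomial in \<open>\<complex>[x,y]\<close> is an element of \<open>\<complex>[x][y]\<close>: the outer variable is \<open>y\<close>, the
  coefficients are polynomials in \<open>x\<close>.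
\<close>

type_synonym bipoly = "complex poly poly"

definition eval2 :: "bipoly \<Rightarrow> complex \<times> complex \<Rightarrow> complex" where
  "eval2 f p = poly (poly f [:snd p:]) (fst p)"

definition grad2 :: "bipoly \<Rightarrow> complex \<times> complex \<Rightarrow> complex \<times> complex" where
  "grad2 f p = (eval2 (map_poly pderiv f) p, eval2 (pderiv f) p)"

definition bilin :: "complex \<times> complex \<Rightarrow> complex \<times> complex \<Rightarrow> complex" where
  "bilin a b = fst a * fst b + snd a * snd b"

text \<open>
  A reduced curve is determined by its set of points, so it is represented by that set; purity of
  dimension one amounts to being the zero set of a single nonconstant polynomial. The reduced
  structure enters through the full vanishing ideal, which is used below for the smooth part and
  the tangent spaces (so no squarefree equation has to be chosen).
\<close>

definition reduced_algebraic_curve :: "(complex \<times> complex) set \<Rightarrow> bool" where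
  "reduced_algebraic_curve X \<longleftrightarrow>
     (\<exists>f. (\<forall>c. f \<noteq> [:[:c:]:]) \<and> X = {p. eval2 f p = 0})"

definition vanishing_ideal :: "(complex \<times> complex) set \<Rightarrow> bipoly set" where
  "vanishing_ideal X = {f. \<forall>p\<in>X. eval2 f p = 0}"

text \<open>
  Jacobian criterion. The rank of the gradients at a point of a curve is at most one, so smoothness
  says that some gradient is nonzero.
\<close>

definition smooth_part :: "(complex \<times> complex) set \<Rightarrow> (complex \<times> complex) set" where
  "smooth_part X = {p \<in> X. \<exists>f \<in> vanishing_ideal X. grad2 f p \<noteq> (0, 0)}"

definition tangent_space ::
    "(complex \<times> complex) set \<Rightarrow> complex \<times> complex \<Rightarrow> (complex \<times> complex) set" where
  "tangent_space X p = {v. \<forall>f \<in> vanishing_ideal X. bilin (grad2 f p) v = 0}"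

definition tangent_line ::
    "(complex \<times> complex) set \<Rightarrow> complex \<times> complex \<Rightarrow> (complex \<times> complex) set" where
  "tangent_line X p = {p + v | v. v \<in> tangent_space X p}"

text \<open>
  \<open>t \<mapsto> (x t, y t)\<close> is a holomorphic immersion near \<open>t\<^sub>0\<close> and a homeomorphism onto a neighbourhood
  of \<open>p\<close> in \<open>X\<close>.
\<close>

definition local_parametrization ::
    "(complex \<times> complex) set \<Rightarrow> complex \<times> complex \<Rightarrow>
     (complex \<Rightarrow> complex) \<Rightarrow> (complex \<Rightarrow> complex) \<Rightarrow> complex \<Rightarrow> bool" where
  "local_parametrization X p x y t\<^sub>0 \<longleftrightarrow>
     (x t\<^sub>0, y t\<^sub>0) = p \<and>
     (\<exists>U V g. open U \<and> t\<^sub>0 \<in> U \<and> open V \<and>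
        x holomorphic_on U \<and> y holomorphic_on U \<and>
        (\<forall>t\<in>U. (deriv x t, deriv y t) \<noteq> (0, 0)) \<and>
        homeomorphism U (X \<inter> V) (\<lambda>t. (x t, y t)) g)"

definition flex ::
    "(complex \<Rightarrow> complex) \<Rightarrow> (complex \<Rightarrow> complex) \<Rightarrow> complex \<Rightarrow> bool" where
  "flex x y t\<^sub>0 \<longleftrightarrow>
     deriv x t\<^sub>0 * (deriv ^^ 2) y t\<^sub>0 - deriv y t\<^sub>0 * (deriv ^^ 2) x t\<^sub>0 = 0"

definition isotropic_tangent ::
    "(complex \<Rightarrow> complex) \<Rightarrow> (complex \<Rightarrow> complex) \<Rightarrow> complex \<Rightarrow> bool" where
  "isotropic_tangent x y t\<^sub>0 \<longleftrightarrow> (deriv x t\<^sub>0)\<^sup>2 + (deriv y t\<^sub>0)\<^sup>2 = 0"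

section \<open>Critical points of the squared distance function\<close>

definition sqdist :: "complex \<times> complex \<Rightarrow> complex \<times> complex \<Rightarrow> complex" where
  "sqdist u p = (fst p - fst u)\<^sup>2 + (snd p - snd u)\<^sup>2"

text \<open>
  Critical and Morse (nondegenerate) critical points on the smooth part are defined in a
  holomorphic chart. Neither notion depends on the chart.
\<close>

definition critical_point ::
    "(complex \<times> complex) set \<Rightarrow> (complex \<times> complex \<Rightarrow> complex) \<Rightarrow> complex \<times> complex \<Rightarrow> bool" where
  "critical_point X F p \<longleftrightarrow> p \<in> smooth_part X \<and>
     (\<exists>x y t\<^sub>0. local_parametrization X p x y t\<^sub>0 \<and>
        deriv (\<lambda>t. F (x t, y t)) t\<^sub>0 = 0)"

definition morse_point ::
    "(complex \<times> complex) set \<Rightarrow> (complex \<times> complex \<Rightarrow> complex) \<Rightarrow> complex \<times> complex \<Rightarrow> bool" where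
  "morse_point X F p \<longleftrightarrow> p \<in> smooth_part X \<and>
     (\<exists>x y t\<^sub>0. local_parametrization X p x y t\<^sub>0 \<and>
        deriv (\<lambda>t. F (x t, y t)) t\<^sub>0 = 0 \<and>
        (deriv ^^ 2) (\<lambda>t. F (x t, y t)) t\<^sub>0 \<noteq> 0)"

text \<open>
  The derivative of \<open>t \<mapsto> sqdist u (x t, y t)\<close> is \<open>2 h(t,u)\<close> with
  \<open>h(t,u) = x'(t) (x(t) - u\<^sub>1) + y'(t) (y(t) - u\<^sub>2)\<close>, so being an attractor means that \<open>h(\<cdot>,u)\<close>
  vanishes to order greater than one at \<open>t\<^sub>0\<close> (infinite order included, as for the centre of a
  circle).
\<close>

definition attractor ::
    "(complex \<times> complex) set \<Rightarrow> complex \<times> complex \<Rightarrow> complex \<times> complex \<Rightarrow> bool" where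
  "attractor X u p \<longleftrightarrow> critical_point X (sqdist u) p \<and> \<not> morse_point X (sqdist u) p"

section \<open>Euclidean distance degree and discriminant\<close>

text \<open>
  The set whose closure is taken is constructible, so its closure in the Euclidean topology is also
  its Zariski closure.
\<close>

definition ED_correspondence ::
    "(complex \<times> complex) set \<Rightarrow> ((complex \<times> complex) \<times> (complex \<times> complex)) set" where
  "ED_correspondence X =
     closure {(p, u). p \<in> smooth_part X \<and> (\<forall>v \<in> tangent_space X p. bilin (u - p) v = 0)}"

text \<open>
  A property holds for generic \<open>u\<close> if it holds off the zero set of some nonzero polynomial.
\<close>

definition ED_degree :: "(complex \<times> complex) set \<Rightarrow> nat" where
  "ED_degree X =
     (THE d. \<exists>q. q \<noteq> 0 \<and>
        (\<forall>u. eval2 q u \<noteq> 0 \<longrightarrow>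
           finite {p. morse_point X (sqdist u) p} \<and> card {p. morse_point X (sqdist u) p} = d))"

text \<open>
  Finiteness is spelled out because \<open>card\<close> is 0 on infinite sets: an infinite fibre always belongs
  to the discriminant, also when the degree is 0 (as for an isotropic line).
\<close>

definition ED_discriminant :: "(complex \<times> complex) set \<Rightarrow> (complex \<times> complex) set" where
  "ED_discriminant X =
     {u. \<not> (finite {z \<in> ED_correspondence X. snd z = u} \<and>
            card {z \<in> ED_correspondence X. snd z = u} = ED_degree X)}"

end

theory Submission
  imports Defs
begin

text \<open>
  Two local parametrizations at \<open>p\<close> differ by a biholomorphic change of parameter, so whether
  \<open>p\<close> is an attractor can be decided in the given chart: it is one iff \<open>h(\<cdot>,u)\<close> and its derivative
  vanish at \<open>t\<^sub>0\<close>. With \<open>w = p - u\<close> this is the linear system \<open>x'w\<^sub>1 + y'w\<^sub>2 = 0\<close>,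
  \<open>x''w\<^sub>1 + y''w\<^sub>2 = - (x'\<^sup>2 + y'\<^sup>2)\<close>, whose determinant is the flex expression.
  At a flex point the two left-hand sides are proportional, so the system is solvable only if the
  tangent is isotropic; then the second equation is redundant and the normal line is the tangent line.
\<close>

section \<open>Change of charts\<close>

text \<open>A function with nonzero derivative has a local holomorphic inverse \<open>k\<close>, and
  \<open>c\<close> equals \<open>k\<close> after \<open>f\<close> after \<open>c\<close> near
  \<open>s\<^sub>0\<close>. So a merely continuous lift through \<open>f\<close> is already
  holomorphic there.\<close>

lemma holomorphic_lift:
  assumes W: "open W" "s\<^sub>0 \<in> W" and c: "continuous_on W c"
    and S: "open S" "c s\<^sub>0 \<in> S" and f: "f holomorphic_on S" "deriv f (c s\<^sub>0) \<noteq> 0"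
    and fc: "(\<lambda>s. f (c s)) holomorphic_on W"
  obtains W' where "open W'" "s\<^sub>0 \<in> W'" "W' \<subseteq> W" "c holomorphic_on W'"
proof -
  obtain r where r: "r > 0" "ball (c s\<^sub>0) r \<subseteq> S" "inj_on f (ball (c s\<^sub>0) r)"
    using has_complex_derivative_locally_injective[OF f(1) S(2,1) f(2)] .
  let ?B = "ball (c s\<^sub>0) r"
  have fB: "f holomorphic_on ?B"
    using f(1) r(2) by (rule holomorphic_on_subset)
  obtain k where k: "k holomorphic_on f ` ?B" "\<And>z. z \<in> ?B \<Longrightarrow> k (f z) = z"
    using holomorphic_has_inverse[OF fB open_ball r(3)] by metis
  \<comment> \<open>Shrinking to the parameters that \<open>c\<close> sends into the ball keeps
    \<open>c\<close> where \<open>k\<close> inverts \<open>f\<close>.\<close>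
  define W' where "W' = W \<inter> c -` ?B"
  have "open W'"
    unfolding W'_def using c W(1) open_ball by (rule continuous_open_preimage)
  moreover have "s\<^sub>0 \<in> W'" "W' \<subseteq> W"
    using W(2) r(1) by (auto simp: W'_def)
  moreover have "c holomorphic_on W'"
  proof -
    have "(k \<circ> (\<lambda>s. f (c s))) holomorphic_on W'"
    proof (rule holomorphic_on_compose_gen)
      show "(\<lambda>s. f (c s)) holomorphic_on W'"
        using fc by (rule holomorphic_on_subset) (auto simp: W'_def)
    qed (use k(1) in \<open>auto simp: W'_def\<close>)
    then show ?thesis
      by (rule holomorphic_transform) (simp add: W'_def k(2))
  qed
  ultimately show thesis by (rule that)
qed

text \<open>The transition map \<open>c\<close> is the inverse chart \<open>g\<close> applied to
  \<open>(a s, b s)\<close>. Charts are only assumed to be homeomorphisms, so at first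
  \<open>c\<close> is just continuous; the immersion condition upgrades it to a biholomorphic change
  of parameter near \<open>s\<^sub>0\<close>.\<close>

lemma local_parametrization_change:
  assumes "local_parametrization X p x y t\<^sub>0" and "local_parametrization X p a b s\<^sub>0"
  obtains c W where "open W" "s\<^sub>0 \<in> W" "c holomorphic_on W" "c s\<^sub>0 = t\<^sub>0" "deriv c s\<^sub>0 \<noteq> 0"
    "\<And>s. s \<in> W \<Longrightarrow> x (c s) = a s \<and> y (c s) = b s"
proof -
  obtain U V g where p: "(x t\<^sub>0, y t\<^sub>0) = p" and U: "open U" "t\<^sub>0 \<in> U" and V: "open V"
    and hol: "x holomorphic_on U" "y holomorphic_on U"
    and imm: "\<And>t. t \<in> U \<Longrightarrow> (deriv x t, deriv y t) \<noteq> (0, 0)"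
    and hom: "homeomorphism U (X \<inter> V) (\<lambda>t. (x t, y t)) g"
    using assms(1) unfolding local_parametrization_def by blast
  obtain U' V' g' where p': "(a s\<^sub>0, b s\<^sub>0) = p" and U': "open U'" "s\<^sub>0 \<in> U'"
    and hol': "a holomorphic_on U'" "b holomorphic_on U'"
    and imm': "\<And>t. t \<in> U' \<Longrightarrow> (deriv a t, deriv b t) \<noteq> (0, 0)"
    and hom': "homeomorphism U' (X \<inter> V') (\<lambda>t. (a t, b t)) g'"
    using assms(2) unfolding local_parametrization_def by blast
  \<comment> \<open>The parameters whose points fall into the patch \<open>X \<inter> V\<close> on
    which \<open>g\<close> is defined.\<close>
  define W where "W = U' \<inter> (\<lambda>s. (a s, b s)) -` V"
  define c where "c = (\<lambda>s. g (a s, b s))"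
  have ab: "continuous_on U' (\<lambda>s. (a s, b s))"
    using hom' by (simp add: homeomorphism_def)
  have XW: "(a s, b s) \<in> X \<inter> V" if "s \<in> W" for s
    using that hom' by (auto simp: W_def homeomorphism_def)
  have pV: "p \<in> V"
    using hom U(2) p by (auto simp: homeomorphism_def)
  have W: "open W" "s\<^sub>0 \<in> W"
    using continuous_open_preimage[OF ab U'(1) V] U'(2) pV p' by (auto simp: W_def)
  have eq: "x (c s) = a s" "y (c s) = b s" "c s \<in> U" if "s \<in> W" for s
    using hom XW[OF that] unfolding homeomorphism_def c_def by auto
  have c0: "c s\<^sub>0 = t\<^sub>0"
    using homeomorphism_apply1[OF hom U(2)] p p' by (simp add: c_def)
  have cont: "continuous_on W c"
    unfolding c_def
    by (rule continuous_on_compose2[of "X \<inter> V" g])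
      (use hom ab XW in \<open>auto simp: homeomorphism_def W_def intro: continuous_on_subset\<close>)
  have WU': "W \<subseteq> U'"
    by (auto simp: W_def)
  have "(\<lambda>s. x (c s)) holomorphic_on W" "(\<lambda>s. y (c s)) holomorphic_on W"
    using hol'[THEN holomorphic_on_subset, OF WU'] eq
    by (auto cong: holomorphic_cong)
  \<comment> \<open>Whichever of \<open>x\<close>, \<open>y\<close> has nonzero derivative serves as
    the function \<open>f\<close> of the lifting lemma.\<close>
  moreover have "deriv x (c s\<^sub>0) \<noteq> 0 \<or> deriv y (c s\<^sub>0) \<noteq> 0"
    using imm U(2) c0 by auto
  ultimately obtain W' where W': "open W'" "s\<^sub>0 \<in> W'" "W' \<subseteq> W" "c holomorphic_on W'"
    using holomorphic_lift[OF W cont U(1) eq(3)[OF W(2)]] hol by metis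
  have "deriv c s\<^sub>0 \<noteq> 0"
  proof
    \<comment> \<open>By the chain rule both \<open>a\<close> and \<open>b\<close> would then have
      zero derivative at \<open>s\<^sub>0\<close>, against the immersion condition of the second
      chart.\<close>
    assume "deriv c s\<^sub>0 = 0"
    then have "(c has_field_derivative 0) (at s\<^sub>0)"
      using holomorphic_derivI[OF W'(4,1,2)] by simp
    then have *: "((\<lambda>s. x (c s)) has_field_derivative deriv x t\<^sub>0 * 0) (at s\<^sub>0)"
      "((\<lambda>s. y (c s)) has_field_derivative deriv y t\<^sub>0 * 0) (at s\<^sub>0)"
      using hol[THEN holomorphic_derivI, OF U] c0 by (metis DERIV_chain2)+
    have "(a has_field_derivative deriv x t\<^sub>0 * 0) (at s\<^sub>0)"
      by (rule has_field_derivative_transform_within_open[OF *(1) W]) (simp add: eq)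
    moreover have "(b has_field_derivative deriv y t\<^sub>0 * 0) (at s\<^sub>0)"
      by (rule has_field_derivative_transform_within_open[OF *(2) W]) (simp add: eq)
    ultimately show False
      using imm'[OF U'(2)] by (simp add: DERIV_imp_deriv)
  qed
  then show thesis
    by (rule that[OF W'(1,2,4) c0]) (use W'(3) eq in auto)
qed

text \<open>At a critical point of \<open>G\<close> the term with the second derivative of
  \<open>c\<close> drops out. When \<open>deriv c s\<^sub>0\<close> is nonzero, vanishing of the
  first derivative, and then of the second, is therefore independent of the chart.\<close>

lemma deriv_reparametrization:
  assumes G: "G holomorphic_on U" "open U" "c s\<^sub>0 \<in> U"
    and c: "c holomorphic_on W" "open W" "s\<^sub>0 \<in> W"
    and eq: "\<And>s. s \<in> W \<Longrightarrow> H s = G (c s)"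
  shows "deriv H s\<^sub>0 = deriv G (c s\<^sub>0) * deriv c s\<^sub>0"
    and "(deriv ^^ 2) H s\<^sub>0 =
      (deriv ^^ 2) G (c s\<^sub>0) * (deriv c s\<^sub>0)\<^sup>2 + deriv G (c s\<^sub>0) * (deriv ^^ 2) c s\<^sub>0"
proof -
  define W' where "W' = W \<inter> c -` U"
  have W': "open W'" "s\<^sub>0 \<in> W'"
    using continuous_open_preimage[OF holomorphic_on_imp_continuous_on[OF c(1)] c(2) G(2)] c(3) G(3)
    by (auto simp: W'_def)
  have d: "deriv H s = deriv G (c s) * deriv c s" if "s \<in> W'" for s
  proof -
    have "((\<lambda>s. G (c s)) has_field_derivative deriv G (c s) * deriv c s) (at s)"
      using that by (intro DERIV_chain2 holomorphic_derivI[OF G(1,2)] holomorphic_derivI[OF c(1,2)])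
        (auto simp: W'_def)
    then have "(H has_field_derivative deriv G (c s) * deriv c s) (at s)"
      by (rule has_field_derivative_transform_within_open[OF _ W'(1) that])
        (simp add: eq W'_def)
    then show ?thesis by (rule DERIV_imp_deriv)
  qed
  show "deriv H s\<^sub>0 = deriv G (c s\<^sub>0) * deriv c s\<^sub>0"
    using W'(2) by (rule d)
  have "((\<lambda>s. deriv G (c s)) has_field_derivative deriv (deriv G) (c s\<^sub>0) * deriv c s\<^sub>0) (at s\<^sub>0)"
    by (intro DERIV_chain2 holomorphic_derivI[OF _ G(2,3)] holomorphic_derivI[OF c]
        holomorphic_deriv[OF G(1,2)])
  moreover have "(deriv c has_field_derivative deriv (deriv c) s\<^sub>0) (at s\<^sub>0)"
    by (intro holomorphic_derivI[OF _ c(2,3)] holomorphic_deriv[OF c(1,2)])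
  ultimately have "((\<lambda>s. deriv G (c s) * deriv c s) has_field_derivative
      deriv (deriv G) (c s\<^sub>0) * deriv c s\<^sub>0 * deriv c s\<^sub>0 + deriv (deriv c) s\<^sub>0 * deriv G (c s\<^sub>0)) (at s\<^sub>0)"
    by (rule DERIV_mult)
  then have "(deriv H has_field_derivative
      deriv (deriv G) (c s\<^sub>0) * deriv c s\<^sub>0 * deriv c s\<^sub>0 + deriv (deriv c) s\<^sub>0 * deriv G (c s\<^sub>0)) (at s\<^sub>0)"
    by (rule has_field_derivative_transform_within_open[OF _ W']) (simp add: d)
  then show "(deriv ^^ 2) H s\<^sub>0 =
      (deriv ^^ 2) G (c s\<^sub>0) * (deriv c s\<^sub>0)\<^sup>2 + deriv G (c s\<^sub>0) * (deriv ^^ 2) c s\<^sub>0"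
    by (simp add: DERIV_imp_deriv numeral_2_eq_2 algebra_simps)
qed

section \<open>Attractors in a chart\<close>

lemma local_parametrization_holomorphic:
  assumes "local_parametrization X p x y t\<^sub>0"
  obtains U where "open U" "t\<^sub>0 \<in> U" "x holomorphic_on U" "y holomorphic_on U"
    "(deriv x t\<^sub>0, deriv y t\<^sub>0) \<noteq> (0, 0)" "\<And>t. t \<in> U \<Longrightarrow> (x t, y t) \<in> X"
proof -
  obtain U V g where "open U" "t\<^sub>0 \<in> U" "x holomorphic_on U" "y holomorphic_on U"
    "\<And>t. t \<in> U \<Longrightarrow> (deriv x t, deriv y t) \<noteq> (0, 0)"
    "homeomorphism U (X \<inter> V) (\<lambda>t. (x t, y t)) g"
    using assms unfolding local_parametrization_def by blast
  then show thesis
    by (intro that) (auto simp: homeomorphism_def)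
qed

text \<open>Critical and Morse points ask for some chart, so their combination in
  \<open>attractor\<close> mixes an existential with a negated one. Chart independence collapses
  both to the given chart.\<close>

lemma attractor_iff_deriv:
  assumes p: "p \<in> smooth_part X" and P: "local_parametrization X p x y t\<^sub>0"
  shows "attractor X u p \<longleftrightarrow>
    deriv (\<lambda>t. sqdist u (x t, y t)) t\<^sub>0 = 0 \<and> (deriv ^^ 2) (\<lambda>t. sqdist u (x t, y t)) t\<^sub>0 = 0"
proof -
  define G where "G = (\<lambda>t. sqdist u (x t, y t))"
  have change: "deriv (\<lambda>s. sqdist u (a s, b s)) s\<^sub>0 = 0 \<longleftrightarrow> deriv G t\<^sub>0 = 0"
    "deriv G t\<^sub>0 = 0 \<Longrightarrow>
      (deriv ^^ 2) (\<lambda>s. sqdist u (a s, b s)) s\<^sub>0 = 0 \<longleftrightarrow> (deriv ^^ 2) G t\<^sub>0 = 0"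
    if Q: "local_parametrization X p a b s\<^sub>0" for a b s\<^sub>0
  proof -
    obtain U where U: "open U" "t\<^sub>0 \<in> U" "x holomorphic_on U" "y holomorphic_on U"
      by (rule local_parametrization_holomorphic[OF P]) (rule that)
    have G: "G holomorphic_on U"
      unfolding G_def sqdist_def using U by (auto intro!: holomorphic_intros)
    obtain c W where W: "open W" "s\<^sub>0 \<in> W" "c holomorphic_on W" "c s\<^sub>0 = t\<^sub>0" "deriv c s\<^sub>0 \<noteq> 0"
      "\<And>s. s \<in> W \<Longrightarrow> x (c s) = a s \<and> y (c s) = b s"
      by (rule local_parametrization_change[OF P Q]) (rule that)
    have eq: "sqdist u (a s, b s) = G (c s)" if "s \<in> W" for s
      using W(6)[OF that] by (simp add: G_def)
    have "c s\<^sub>0 \<in> U"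
      using U(2) W(4) by simp
    note reparam = deriv_reparametrization[OF G U(1) this W(3,1,2) eq]
    show "deriv (\<lambda>s. sqdist u (a s, b s)) s\<^sub>0 = 0 \<longleftrightarrow> deriv G t\<^sub>0 = 0"
      using W(4,5) by (simp add: reparam(1))
    show "(deriv ^^ 2) (\<lambda>s. sqdist u (a s, b s)) s\<^sub>0 = 0 \<longleftrightarrow> (deriv ^^ 2) G t\<^sub>0 = 0"
      if "deriv G t\<^sub>0 = 0"
      using W(4,5) that by (simp only: reparam(2)) simp
  qed
  have "critical_point X (sqdist u) p \<longleftrightarrow> deriv G t\<^sub>0 = 0"
    using p P by (auto simp: critical_point_def change(1) cong: conj_cong)
  moreover have "morse_point X (sqdist u) p \<longleftrightarrow> deriv G t\<^sub>0 = 0 \<and> (deriv ^^ 2) G t\<^sub>0 \<noteq> 0"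
    using p P by (auto simp: morse_point_def change cong: conj_cong)
  ultimately show ?thesis
    unfolding attractor_def G_def by blast
qed

lemma sqdist_deriv:
  assumes U: "open U" "t\<^sub>0 \<in> U" and hol: "x holomorphic_on U" "y holomorphic_on U"
  shows "deriv (\<lambda>t. sqdist u (x t, y t)) t\<^sub>0 =
      2 * (deriv x t\<^sub>0 * (x t\<^sub>0 - fst u) + deriv y t\<^sub>0 * (y t\<^sub>0 - snd u))"
    and "(deriv ^^ 2) (\<lambda>t. sqdist u (x t, y t)) t\<^sub>0 =
      2 * ((deriv ^^ 2) x t\<^sub>0 * (x t\<^sub>0 - fst u) + (deriv ^^ 2) y t\<^sub>0 * (y t\<^sub>0 - snd u)
        + ((deriv x t\<^sub>0)\<^sup>2 + (deriv y t\<^sub>0)\<^sup>2))"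
proof -
  have d: "deriv (\<lambda>t. sqdist u (x t, y t)) t =
      2 * (deriv x t * (x t - fst u) + deriv y t * (y t - snd u))" if "t \<in> U" for t
    unfolding sqdist_def
    by (rule DERIV_imp_deriv)
      (auto intro!: derivative_eq_intros holomorphic_derivI[OF hol(1) U(1) that]
        holomorphic_derivI[OF hol(2) U(1) that] simp: algebra_simps)
  show "deriv (\<lambda>t. sqdist u (x t, y t)) t\<^sub>0 =
      2 * (deriv x t\<^sub>0 * (x t\<^sub>0 - fst u) + deriv y t\<^sub>0 * (y t\<^sub>0 - snd u))"
    using U(2) by (rule d)
  have "((\<lambda>t. 2 * (deriv x t * (x t - fst u) + deriv y t * (y t - snd u))) has_field_derivative
      2 * (deriv (deriv x) t\<^sub>0 * (x t\<^sub>0 - fst u) + deriv (deriv y) t\<^sub>0 * (y t\<^sub>0 - snd u)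
        + ((deriv x t\<^sub>0)\<^sup>2 + (deriv y t\<^sub>0)\<^sup>2))) (at t\<^sub>0)"
    by (auto intro!: derivative_eq_intros hol[THEN holomorphic_derivI, OF U]
        hol[THEN holomorphic_deriv, OF U(1), THEN holomorphic_derivI, OF U]
        simp: algebra_simps power2_eq_square)
  then have "(deriv (\<lambda>t. sqdist u (x t, y t)) has_field_derivative
      2 * (deriv (deriv x) t\<^sub>0 * (x t\<^sub>0 - fst u) + deriv (deriv y) t\<^sub>0 * (y t\<^sub>0 - snd u)
        + ((deriv x t\<^sub>0)\<^sup>2 + (deriv y t\<^sub>0)\<^sup>2))) (at t\<^sub>0)"
    by (rule has_field_derivative_transform_within_open[OF _ U]) (simp add: d)
  then show "(deriv ^^ 2) (\<lambda>t. sqdist u (x t, y t)) t\<^sub>0 =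
      2 * ((deriv ^^ 2) x t\<^sub>0 * (x t\<^sub>0 - fst u) + (deriv ^^ 2) y t\<^sub>0 * (y t\<^sub>0 - snd u)
        + ((deriv x t\<^sub>0)\<^sup>2 + (deriv y t\<^sub>0)\<^sup>2))"
    by (simp add: DERIV_imp_deriv numeral_2_eq_2)
qed

lemma attractor_iff:
  assumes p: "p \<in> smooth_part X" and P: "local_parametrization X p x y t\<^sub>0"
  shows "attractor X u p \<longleftrightarrow>
    deriv x t\<^sub>0 * (fst p - fst u) + deriv y t\<^sub>0 * (snd p - snd u) = 0 \<and>
    (deriv ^^ 2) x t\<^sub>0 * (fst p - fst u) + (deriv ^^ 2) y t\<^sub>0 * (snd p - snd u)
      + ((deriv x t\<^sub>0)\<^sup>2 + (deriv y t\<^sub>0)\<^sup>2) = 0"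
proof -
  obtain U where U: "open U" "t\<^sub>0 \<in> U" "x holomorphic_on U" "y holomorphic_on U"
    by (rule local_parametrization_holomorphic[OF P]) (rule that)
  have "x t\<^sub>0 = fst p" "y t\<^sub>0 = snd p"
    using P by (auto simp: local_parametrization_def)
  then show ?thesis
    by (simp only: attractor_iff_deriv[OF p P] sqdist_deriv[OF U] mult_eq_0_iff
        zero_neq_numeral[symmetric] simp_thms)
qed

text \<open>Cramer's rule for the right-hand side \<open>(0, -e)\<close>. Both directions work with
  the unknowns multiplied by the determinant, which keeps the identities polynomial until it is
  cancelled.\<close>

lemma cramer_2:
  fixes a b c d e :: "'a :: field"
  assumes D: "a * d - b * c \<noteq> 0"
  shows "a * w + b * z = 0 \<and> c * w + d * z + e = 0 \<longleftrightarrow>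
    w = b * e / (a * d - b * c) \<and> z = - a * e / (a * d - b * c)"
proof
  assume "a * w + b * z = 0 \<and> c * w + d * z + e = 0"
  then have "w * (a * d - b * c) = b * e" "z * (a * d - b * c) = - a * e"
    by algebra+
  then show "w = b * e / (a * d - b * c) \<and> z = - a * e / (a * d - b * c)"
    by (simp only: nonzero_eq_divide_eq[OF D])
next
  assume "w = b * e / (a * d - b * c) \<and> z = - a * e / (a * d - b * c)"
  then have *: "w * (a * d - b * c) = b * e" "z * (a * d - b * c) = - a * e"
    using D by (simp_all add: nonzero_eq_divide_eq)
  then have "(a * w + b * z) * (a * d - b * c) = 0" "(c * w + d * z + e) * (a * d - b * c) = 0"
    by algebra+
  then show "a * w + b * z = 0 \<and> c * w + d * z + e = 0"
    using D by simp
qed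

section \<open>Tangent vectors\<close>

lemma eval2_pCons: "eval2 (pCons c f) z = poly c (fst z) + snd z * eval2 f z"
  by (simp add: eval2_def)

lemma eval2_add: "eval2 (f + g) z = eval2 f z + eval2 g z"
  by (simp add: eval2_def)

text \<open>Induction along the Horner form in \<open>y\<close>: each step adds a polynomial in
  \<open>x\<close> to \<open>y\<close> times the remaining polynomial, so the sum and product rules
  suffice.\<close>

lemma eval2_chain_rule:
  assumes x: "(x has_field_derivative x') (at t)" and y: "(y has_field_derivative y') (at t)"
  shows "((\<lambda>t. eval2 f (x t, y t)) has_field_derivative
    bilin (grad2 f (x t, y t)) (x', y')) (at t)"
proof (induction f)
  case 0
  then show ?case by (simp add: eval2_def grad2_def bilin_def)
next
  case (pCons c f)
  have "((\<lambda>t. poly c (x t)) has_field_derivative poly (pderiv c) (x t) * x') (at t)"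
    by (rule DERIV_chain2[OF poly_DERIV x])
  note DERIV_add[OF this DERIV_mult[OF y pCons.IH]]
  then show ?case
    by (simp add: eval2_pCons eval2_add grad2_def bilin_def map_poly_pCons pderiv_pCons
        algebra_simps)
qed

text \<open>Both \<open>v\<close> and the velocity of the chart are annihilated by one nonzero
  gradient, whose kernel in the plane is a line. This links the algebraic tangent line to the
  derivatives of the chart.\<close>

lemma tangent_space_parallel:
  assumes p: "p \<in> smooth_part X" and P: "local_parametrization X p x y t\<^sub>0"
    and v: "v \<in> tangent_space X p"
  shows "fst v * deriv y t\<^sub>0 = snd v * deriv x t\<^sub>0"
proof -
  obtain U where U: "open U" "t\<^sub>0 \<in> U" and hol: "x holomorphic_on U" "y holomorphic_on U"
    and X: "\<And>t. t \<in> U \<Longrightarrow> (x t, y t) \<in> X"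
    by (rule local_parametrization_holomorphic[OF P]) (rule that)
  have p_eq: "p = (x t\<^sub>0, y t\<^sub>0)"
    using P by (simp add: local_parametrization_def)
  obtain f where f: "f \<in> vanishing_ideal X" "grad2 f p \<noteq> (0, 0)"
    using p by (auto simp: smooth_part_def)
  have "((\<lambda>t. eval2 f (x t, y t)) has_field_derivative
      bilin (grad2 f p) (deriv x t\<^sub>0, deriv y t\<^sub>0)) (at t\<^sub>0)"
    unfolding p_eq by (intro eval2_chain_rule hol[THEN holomorphic_derivI, OF U])
  \<comment> \<open>The chart stays in \<open>X\<close>, where \<open>f\<close> vanishes, so
    \<open>f\<close> is constantly zero along it.\<close>
  moreover have "((\<lambda>t. eval2 f (x t, y t)) has_field_derivative 0) (at t\<^sub>0)"
    by (rule has_field_derivative_transform_within_open[OF DERIV_const[of 0] U])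
      (use X f(1) in \<open>auto simp: vanishing_ideal_def\<close>)
  ultimately have "bilin (grad2 f p) (deriv x t\<^sub>0, deriv y t\<^sub>0) = 0"
    by (rule DERIV_unique)
  moreover have "bilin (grad2 f p) v = 0"
    using v f(1) by (simp add: tangent_space_def)
  moreover obtain m n where mn: "grad2 f p = (m, n)"
    by fastforce
  ultimately have "m * deriv x t\<^sub>0 + n * deriv y t\<^sub>0 = 0" "m * fst v + n * snd v = 0"
    by (simp_all add: bilin_def)
  then have "m * (fst v * deriv y t\<^sub>0 - snd v * deriv x t\<^sub>0) = 0"
    "n * (fst v * deriv y t\<^sub>0 - snd v * deriv x t\<^sub>0) = 0"
    by algebra+
  then show ?thesis
    using f(2) mn by auto
qed

theorem theorem5p2:
  fixes X :: "(complex \<times> complex) set" and p :: "complex \<times> complex"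
    and x y :: "complex \<Rightarrow> complex" and t\<^sub>0 :: complex
  assumes "reduced_algebraic_curve X"
    and "p \<in> smooth_part X"
    and "local_parametrization X p x y t\<^sub>0"
  shows "(\<not> flex x y t\<^sub>0 \<longrightarrow> (\<exists>!u. attractor X u p)) \<and>
    (flex x y t\<^sub>0 \<and> \<not> isotropic_tangent x y t\<^sub>0 \<longrightarrow>
       (\<forall>u \<in> ED_discriminant X. \<not> attractor X u p)) \<and>
    (flex x y t\<^sub>0 \<and> isotropic_tangent x y t\<^sub>0 \<longrightarrow>
       (\<forall>u \<in> tangent_line X p. attractor X u p))"
proof -
  note att = attractor_iff[OF assms(2,3)]
  let ?a = "deriv x t\<^sub>0" and ?b = "deriv y t\<^sub>0"
  let ?c = "(deriv ^^ 2) x t\<^sub>0" and ?d = "(deriv ^^ 2) y t\<^sub>0"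
  have ab: "?a \<noteq> 0 \<or> ?b \<noteq> 0"
    by (rule local_parametrization_holomorphic[OF assms(3)]) auto
  have "\<exists>!u. attractor X u p" if "\<not> flex x y t\<^sub>0"
  proof -
    have D: "?a * ?d - ?b * ?c \<noteq> 0"
      using that by (simp add: flex_def)
    \<comment> \<open>\<open>(w, z)\<close> is the solution of the linear system for
      \<open>p - u\<close>; the resulting \<open>u\<close> is the centre of curvature of
      \<open>X\<close> at \<open>p\<close>.\<close>
    define w where "w = ?b * (?a\<^sup>2 + ?b\<^sup>2) / (?a * ?d - ?b * ?c)"
    define z where "z = - ?a * (?a\<^sup>2 + ?b\<^sup>2) / (?a * ?d - ?b * ?c)"
    have "attractor X u p \<longleftrightarrow> fst p - fst u = w \<and> snd p - snd u = z" for u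
      unfolding att cramer_2[OF D] w_def z_def ..
    also have "\<dots> u \<longleftrightarrow> u = (fst p - w, snd p - z)" for u
      by (auto simp: prod_eq_iff algebra_simps)
    finally show ?thesis by simp
  qed
  moreover have "\<not> attractor X u p" if "flex x y t\<^sub>0" "\<not> isotropic_tangent x y t\<^sub>0" for u
  proof
    assume "attractor X u p"
    then have "?a * (fst p - fst u) + ?b * (snd p - snd u) = 0"
      "?c * (fst p - fst u) + ?d * (snd p - snd u) + (?a\<^sup>2 + ?b\<^sup>2) = 0"
      by (simp_all add: att)
    moreover have "?a * ?d - ?b * ?c = 0"
      using that(1) by (simp add: flex_def)
    \<comment> \<open>Multiply the second equation by \<open>?a\<close> or \<open>?b\<close>. Since
      \<open>?a * ?d = ?b * ?c\<close>, its linear part becomes \<open>?c\<close> or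
      \<open>?d\<close> times the first left-hand side, hence zero.\<close>
    ultimately have "?a * (?a\<^sup>2 + ?b\<^sup>2) = 0" "?b * (?a\<^sup>2 + ?b\<^sup>2) = 0"
      by algebra+
    then show False
      using ab that(2) by (auto simp: isotropic_tangent_def)
  qed
  moreover have "attractor X u p"
    if flex: "flex x y t\<^sub>0" and iso: "isotropic_tangent x y t\<^sub>0"
      and u: "u \<in> tangent_line X p" for u
  proof -
    obtain v where v: "v \<in> tangent_space X p" "u = p + v"
      using u by (auto simp: tangent_line_def)
    have par: "fst v * ?b = snd v * ?a"
      using tangent_space_parallel[OF assms(2,3) v(1)] .
    have flex: "?a * ?d - ?b * ?c = 0" and iso: "?a\<^sup>2 + ?b\<^sup>2 = 0"
      using flex iso by (simp_all add: flex_def isotropic_tangent_def)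
    \<comment> \<open>Parallelism turns the two products into
      \<open>(?a\<^sup>2 + ?b\<^sup>2) * fst v\<close> and
      \<open>(?a\<^sup>2 + ?b\<^sup>2) * snd v\<close>: an isotropic direction is orthogonal to
      itself.\<close>
    have "?a * (?a * fst v + ?b * snd v) = 0" "?b * (?a * fst v + ?b * snd v) = 0"
      using par iso by algebra+
    then have 1: "?a * fst v + ?b * snd v = 0"
      using ab by auto
    \<comment> \<open>The flex condition makes \<open>(?c, ?d)\<close> proportional to the nonzero
      vector \<open>(?a, ?b)\<close>, so orthogonality to \<open>v\<close> carries over.\<close>
    have "?a * (?c * fst v + ?d * snd v) = 0" "?b * (?c * fst v + ?d * snd v) = 0"
      using 1 flex by algebra+
    then have 2: "?c * fst v + ?d * snd v = 0"
      using ab by auto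
    have "fst p - fst u = - fst v" "snd p - snd u = - snd v"
      using v(2) by simp_all
    then show ?thesis
      unfolding att using 1 2 iso by (simp add: add_eq_0_iff)
  qed
  ultimately show ?thesis by (intro conjI impI ballI) simp_all
qed

end
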